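(* The average achievable D2D sum-rate of the fixed transmission probability (FTP) scheme can be expressed as $$R_s^{\mathsf{FTP}}=\frac{\lambda_t^{\mathsf{FTP}}\,\pi R^2}{2\ln 2}\int_0^\infty\frac{1-P_{out,d}^{\mathsf{FTP}}(x)}{1+x}\,dx,$$ where $\lambda_t^{\mathsf{FTP}}$ is the density of operable and transmitting D2D users and $P_{out,d}^{\mathsf{FTP}}$ is the D2D outage probability.
   Context: A base station (BS) is at the center of a cell of radius $R$; a cellular user is randomly located within the cell and transmits in uplink sub-slots with power $P_c$. D2D transmitters are distributed according to a homogeneous Poisson point process of density $\lambda_d$; each D2D receiver is at distance $r_d$ from its transmitter. Time slots consist of a downlink and an uplink sub-slot of equal duration; D2D users transmit only in the uplink. Each D2D transmitter harvests energy in downlink sub-slots from the BS (power $P_b$, conversion efficiency $0<\eta\le1$) and is operable if its battery level is at least a threshold $E_{th}$. In the FTP scheme each operable D2D transmitter transmits in the uplink sub-slot, with power $P_d$, with fixed probability $p_t^{\mathsf{FTP}}$. With $\mu_1=\frac{\eta P_b}{P_dp_t^{\mathsf{FTP}}}$, the probability of being operable is $\pi_o^{\mathsf{FTP}}=\frac{\alpha\mu_1^{2/\alpha}}{(\alpha-2)R^2}+\frac{2\mu_1}{(2-\alpha)R^\alpha}$ if $\mu_1^{1/\alpha}\le R$ and $\pi_o^{\mathsf{FTP}}=1$ if $\mu_1^{1/\alpha}>R$; then $\lambda_t^{\mathsf{FTP}}=\lambda_d\,\pi_o^{\mathsf{FTP}}\,p_t^{\mathsf{FTP}}$, and $\phi_t$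 denotes the set of operable and transmitting D2D transmitters. The SINR at the $i$-th D2D receiver is $$\Gamma_i=\frac{P_d|h_{i,i}|^2r_d^{-\alpha}}{\sum_{j\in\phi_t,\,j\ne i}P_d|h_{j,i}|^2d_{j,i}^{-\alpha}+P_c|h_{c,i}|^2d_{c,i}^{-\alpha}+N_0},$$ where $\alpha$ is the path loss exponent, $d_{j,i}$ and $d_{c,i}$ are the distances from D2D transmitter $j$ and from the cellular user to receiver $i$, $N_0$ is the noise power, and the gains $|h_{i,i}|^2,|h_{j,i}|^2,|h_{c,i}|^2$ are exponentially distributed with mean $1$ (Rayleigh fading). $P_{out,d}^{\mathsf{FTP}}(x)$ is the probability that the SINR at a D2D receiver is less than $x$; the paper evaluates it by the approximation $$P_{out,d}^{\mathsf{FTP}}(x)\approx1-\exp\!\left(-\frac{xN_0}{P_dr_d^{-\alpha}}\right)\exp\!\left(-\pi\lambda_t^{\mathsf{FTP}}r_d^2x^{2/\alpha}\,\Gamma\!\left(1-\tfrac2\alpha\right)\Gamma\!\left(1+\tfrac2\alpha\right)\right)\frac{R\pi}{K}\sum_{k=1}^K\frac{\sqrt{1-x_k^2}}{1+\frac{xP_cb_k^{-\alpha}}{P_dr_d^{-\alpha}}}f_{d_{c,i}}(b_k),$$ with $\Gamma(\cdot)$ of a numerical argument the Gamma function, $K$ an accuracy-complexity parameter, $x_k=\cos\left(\frac{2k-1}{2K}\pi\right)$, $b_k=Rx_k+R$, and $f_{d_{c,i}}(r)=\frac{2r}{R^2}\left(\frac2\pi\arccos\frac{r}{2R}-\frac{r}{\pi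 R}\sqrt{1-\frac{r^2}{4R^2}}\right)$ on $[0,2R]$ the density of $d_{c,i}$. The average number of transmitting operable transmitters is $N_t^{\mathsf{FTP}}=\lambda_t^{\mathsf{FTP}}\pi R^2$, and the average achievable D2D sum-rate is $$R_s^{\mathsf{FTP}}=\frac12\,\mathbb{E}\left[\sum_{n=1}^{N_t^{\mathsf{FTP}}}\log_2(1+\Gamma_n)\right]=\frac12\lambda_t^{\mathsf{FTP}}\pi R^2\,\mathbb{E}\left[\log_2(1+\Gamma_d)\right],$$ where $\Gamma_n$ are the SINRs of the D2D links and $\Gamma_d$ is the SINR of a generic D2D link. *)

theory Defs
  imports "HOL-Probability.Probability"
begin

text \<open>
  The base station sits at the origin of the plane \<^typ>\<open>real^2\<close>. D2D pairs are indexed by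
  \<^typ>\<open>nat\<close>: pair \<open>j\<close> has transmitter \<open>tx_pos S j\<close> and receiver \<open>rx_pos S j\<close>.
  \<open>gain S j i\<close> is the power gain (squared modulus of the fading coefficient) from
  transmitter \<open>j\<close> to receiver \<open>i\<close>, and \<open>cell_gain S i\<close> the one from the cellular user to
  receiver \<open>i\<close>. \<open>access S j\<close> is the random decision of transmitter \<open>j\<close> to transmit in the
  uplink sub-slot in case it is operable.
\<close>

record 'a ftp_system =
  cell_radius :: real
  bs_power :: real
  cell_power :: real
  d2d_power :: real
  noise_power :: real
  d2d_density :: real
  link_dist :: real
  path_loss :: real
  efficiency :: real
  tx_prob :: real
  prob_sp :: "'a measure"
  tx_pos :: "nat \<Rightarrow> 'a \<Rightarrow> real^2"
  rx_pos :: "nat \<Rightarrow> 'a \<Rightarrow> real^2"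
  cell_user :: "'a \<Rightarrow> real^2"
  operable :: "nat \<Rightarrow> 'a \<Rightarrow> bool"
  access :: "nat \<Rightarrow> 'a \<Rightarrow> bool"
  gain :: "nat \<Rightarrow> nat \<Rightarrow> 'a \<Rightarrow> real"
  cell_gain :: "nat \<Rightarrow> 'a \<Rightarrow> real"

definition mu1 :: "('a, 'z) ftp_system_scheme \<Rightarrow> real" where
  "mu1 S = efficiency S * bs_power S / (d2d_power S * tx_prob S)"

definition operable_prob :: "('a, 'z) ftp_system_scheme \<Rightarrow> real" where
  "operable_prob S =
    (let \<alpha> = path_loss S; R = cell_radius S; \<mu> = mu1 S in
     if \<mu> powr (1 / \<alpha>) \<le> R
     then \<alpha> * \<mu> powr (2 / \<alpha>) / ((\<alpha> - 2) * R\<^sup>2) + 2 * \<mu> / ((2 - \<alpha>) * R powr \<alpha>)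
     else 1)"

definition active_density :: "('a, 'z) ftp_system_scheme \<Rightarrow> real" where
  "active_density S = d2d_density S * operable_prob S * tx_prob S"

definition cell :: "('a, 'z) ftp_system_scheme \<Rightarrow> (real^2) set" where
  "cell S = cball 0 (cell_radius S)"

text \<open>The random set \<open>\<phi>\<^sub>t\<close> of operable and transmitting D2D transmitters.\<close>

definition active :: "('a, 'z) ftp_system_scheme \<Rightarrow> 'a \<Rightarrow> nat set" where
  "active S \<omega> = {j. operable S j \<omega> \<and> access S j \<omega>}"

definition active_in_cell :: "('a, 'z) ftp_system_scheme \<Rightarrow> 'a \<Rightarrow> nat set" where
  "active_in_cell S \<omega> = {j \<in> active S \<omega>. tx_pos S j \<omega> \<in> cell S}"

text \<open>
  Interference is accumulated in \<^typ>\<open>ennreal\<close>, so that a divergent sum (or a transmitter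
  placed exactly at the receiver) counts as infinite interference, hence zero SINR, rather
  than as the default value \<open>0\<close> of a non-summable real family or of a real division by zero.
\<close>

definition received_power :: "('a, 'z) ftp_system_scheme \<Rightarrow> real \<Rightarrow> real \<Rightarrow> real \<Rightarrow> ennreal" where
  "received_power S p g d = ennreal (p * g) / ennreal (d powr path_loss S)"

definition d2d_interference :: "('a, 'z) ftp_system_scheme \<Rightarrow> nat \<Rightarrow> 'a \<Rightarrow> ennreal" where
  "d2d_interference S i \<omega> =
    (\<Sum>\<^sub>\<infinity>j\<in>active S \<omega> - {i}.
       received_power S (d2d_power S) (gain S j i \<omega>) (dist (tx_pos S j \<omega>) (rx_pos S i \<omega>)))"

definition sinr :: "('a, 'z) ftp_system_scheme \<Rightarrow> nat \<Rightarrow> 'a \<Rightarrow> real" where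
  "sinr S i \<omega> = enn2real
    (received_power S (d2d_power S) (gain S i i \<omega>) (link_dist S) /
     (d2d_interference S i \<omega>
      + received_power S (cell_power S) (cell_gain S i \<omega>) (dist (cell_user S \<omega>) (rx_pos S i \<omega>))
      + ennreal (noise_power S)))"

text \<open>
  A generic element of a random index set \<open>A\<close>: a pair \<open>(\<omega>, i)\<close> with \<open>i \<in> A \<omega>\<close>, distributed
  according to \<open>\<bbbE>[\<Sum>i\<in>A. f (\<omega>, i)] / \<bbbE>[card A]\<close> (the Palm distribution of a point process).
\<close>

definition generic :: "'a measure \<Rightarrow> ('a \<Rightarrow> nat set) \<Rightarrow> ('a \<times> nat) measure" where
  "generic M A =
    uniform_measure (M \<Otimes>\<^sub>M count_space UNIV) {(\<omega>, i). \<omega> \<in> space M \<and> i \<in> A \<omega>}"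

definition generic_link :: "('a, 'z) ftp_system_scheme \<Rightarrow> ('a \<times> nat) measure" where
  "generic_link S = generic (prob_sp S) (active_in_cell S)"

definition generic_sinr :: "('a, 'z) ftp_system_scheme \<Rightarrow> 'a \<times> nat \<Rightarrow> real" where
  "generic_sinr S z = sinr S (snd z) (fst z)"

definition outage_prob :: "('a, 'z) ftp_system_scheme \<Rightarrow> real \<Rightarrow> real" where
  "outage_prob S x = \<P>(z in generic_link S. generic_sinr S z < x)"

definition total_rate :: "('a, 'z) ftp_system_scheme \<Rightarrow> 'a \<Rightarrow> real" where
  "total_rate S \<omega> = (\<Sum>i\<in>active_in_cell S \<omega>. log 2 (1 + sinr S i \<omega>))"

text \<open>The factor \<open>1/2\<close> is the share of the uplink sub-slot in a time slot.\<close>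

definition avg_sum_rate :: "('a, 'z) ftp_system_scheme \<Rightarrow> real" where
  "avg_sum_rate S = 1 / 2 * (\<integral>\<omega>. total_rate S \<omega> \<partial>prob_sp S)"

text \<open>
  The first clause on counts makes \<open>card\<close> meaningful in the others; countable families of
  sets in the last clause subsume finite ones (pad with the empty set).
\<close>

definition homogeneous_ppp ::
    "'a measure \<Rightarrow> real \<Rightarrow> (nat \<Rightarrow> 'a \<Rightarrow> 'b::euclidean_space) \<Rightarrow> bool" where
  "homogeneous_ppp M l X \<longleftrightarrow>
    (\<forall>j. X j \<in> borel_measurable M) \<and>
    (\<forall>A\<in>sets borel. bounded A \<longrightarrow>
      (AE \<omega> in M. finite {j. X j \<omega> \<in> A}) \<and>
      (\<forall>k. \<P>(\<omega> in M. card {j. X j \<omega> \<in> A} = k) =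
           (l * measure lborel A) ^ k / fact k * exp (- (l * measure lborel A)))) \<and>
    (\<forall>A :: nat \<Rightarrow> 'b set. (\<forall>n. A n \<in> sets borel \<and> bounded (A n)) \<and> disjoint_family A \<longrightarrow>
      prob_space.indep_vars M (\<lambda>_. count_space UNIV) (\<lambda>n \<omega>. card {j. X j \<omega> \<in> A n}) UNIV)"

text \<open>
  The independent sources of randomness. Positions and operability form a single source:
  operability is the result of harvesting from the base station and may depend on the
  transmitter's position.
\<close>

datatype source = Pairs | Cell_User | Access nat | Gain nat nat | Cell_Gain nat

fun source_events :: "('a, 'z) ftp_system_scheme \<Rightarrow> source \<Rightarrow> 'a set set" where
  "source_events S Pairs = sets (vimage_algebra (space (prob_sp S))
     (\<lambda>\<omega> j. (tx_pos S j \<omega>, rx_pos S j \<omega>, operable S j \<omega>))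
     (\<Pi>\<^sub>M j\<in>UNIV. borel \<Otimes>\<^sub>M borel \<Otimes>\<^sub>M count_space UNIV))"
| "source_events S Cell_User = sets (vimage_algebra (space (prob_sp S)) (cell_user S) borel)"
| "source_events S (Access j) =
     sets (vimage_algebra (space (prob_sp S)) (access S j) (count_space UNIV))"
| "source_events S (Gain j i) = sets (vimage_algebra (space (prob_sp S)) (gain S j i) borel)"
| "source_events S (Cell_Gain i) = sets (vimage_algebra (space (prob_sp S)) (cell_gain S i) borel)"

text \<open>
  Operability is constrained only through the probability that a generic D2D transmitter of
  the cell is operable. The value \<^const>\<open>operable_prob\<close> is itself an average over the cell,
  namely that of \<open>min 1 (\<mu>\<^sub>1 r\<^sup>-\<^sup>\<alpha>)\<close> over a uniform position at distance \<open>r\<close> from the base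
  station, so it is not required to hold at each position separately.
\<close>

locale ftp_network =
  fixes S :: "'a ftp_system"
  assumes radius_pos: "0 < cell_radius S"
    and powers_pos: "0 < bs_power S" "0 < cell_power S" "0 < d2d_power S" "0 < noise_power S"
    and density_pos: "0 < d2d_density S"
    and link_dist_pos: "0 < link_dist S"
    and path_loss_gt_2: "2 < path_loss S"
    and efficiency: "0 < efficiency S" "efficiency S \<le> 1"
    and tx_prob: "0 < tx_prob S" "tx_prob S \<le> 1"
    and prob_space_prob_sp: "prob_space (prob_sp S)"
    and tx_ppp: "homogeneous_ppp (prob_sp S) (d2d_density S) (tx_pos S)"
    and rx_measurable: "\<And>j. rx_pos S j \<in> borel_measurable (prob_sp S)"
    and rx_dist: "\<And>j \<omega>. \<omega> \<in> space (prob_sp S) \<Longrightarrow>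
                    dist (tx_pos S j \<omega>) (rx_pos S j \<omega>) = link_dist S"
    and cell_user_measurable: "cell_user S \<in> borel_measurable (prob_sp S)"
    and cell_user_uniform:
      "distr (prob_sp S) borel (cell_user S) = uniform_measure lborel (cell S)"
    and operable_measurable: "\<And>j. Measurable.pred (prob_sp S) (operable S j)"
    and operable_generic:
      "\<P>(z in generic (prob_sp S) (\<lambda>\<omega>. {j. tx_pos S j \<omega> \<in> cell S}).
          operable S (snd z) (fst z)) = operable_prob S"
    and access_measurable: "\<And>j. Measurable.pred (prob_sp S) (access S j)"
    and access_prob: "\<And>j. \<P>(\<omega> in prob_sp S. access S j \<omega>) = tx_prob S"
    and gain_exponential:
      "\<And>j i. distributed (prob_sp S) lborel (gain S j i) (exponential_density 1)"
    and cell_gain_exponential: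
      "\<And>i. distributed (prob_sp S) lborel (cell_gain S i) (exponential_density 1)"
    and independent_sources: "prob_space.indep_sets (prob_sp S) (source_events S) UNIV"

end

theory Submission
  imports Defs
begin

text \<open>
  The number of active transmitters in the cell has mean \<open>m = \<lambda>\<^sub>t \<pi> R\<^sup>2\<close>: the Poisson count of
  transmitters has mean \<open>\<lambda>\<^sub>d \<pi> R\<^sup>2\<close>, the share of operable ones is \<open>\<pi>\<^sub>o\<close>, and the access
  decision is independent of position and operability. The Palm distribution of a link is the
  measure \<open>P \<otimes> count\<close> restricted to the graph of the active set and divided by \<open>m\<close>, so Fubini
  gives \<open>E[\<Sum>\<^sub>i f(i)] = m E\<^sub>P\<^sub>a\<^sub>l\<^sub>m[f]\<close>. With \<open>ln (1 + y) = \<integral>\<^sub>0\<^sup>y dx / (1 + x)\<close>, Tonelli turns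
  \<open>E\<^sub>P\<^sub>a\<^sub>l\<^sub>m[ln (1 + \<Gamma>)]\<close> into the integral of \<open>P(\<Gamma> \<ge> x) / (1 + x)\<close>. All integrals are finite
  because the SINR is at most a constant times the gain of the own link, which is exponential
  and independent of the link being active.
\<close>

section \<open>Extended nonnegative sums and countable index factors\<close>

lemma infsum_ennreal_eq_suminf:
  fixes f :: "nat \<Rightarrow> ennreal"
  shows "infsum f A = (\<Sum>j. if j \<in> A then f j else 0)"
proof -
  let ?g = "\<lambda>j. if j \<in> A then f j else 0"
  have "infsum f A = infsum ?g UNIV"
    by (rule infsum_cong_neutral) auto
  moreover have "?g sums infsum ?g UNIV"
    by (intro has_sum_imp_sums has_sum_infsum nonneg_summable_on_complete) simp
  ultimately show ?thesis by (simp add: sums_iff)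
qed

lemma ennreal_inverse_antimono: "a \<le> b \<Longrightarrow> inverse b \<le> inverse (a :: ennreal)"
  by (simp add: less_eq_ennreal.rep_eq inverse_ennreal.rep_eq ereal_inverse_antimono enn2ereal_nonneg)

text \<open>A preimage is the countable union over \<open>i\<close> of its slices at
  \<open>i\<close>, each of which is measurable. Functions of a link \<open>(\<omega>, i)\<close>
  can thus be treated one index at a time.\<close>

lemma measurable_pair_countable:
  fixes f :: "'a \<times> 'b::countable \<Rightarrow> 'c"
  assumes "\<And>i. (\<lambda>\<omega>. f (\<omega>, i)) \<in> measurable M N"
  shows "f \<in> measurable (M \<Otimes>\<^sub>M count_space (UNIV :: 'b::countable set)) N"
proof -
  have "(\<lambda>z. (\<lambda>i z. f (fst z, i)) (snd z) z) \<in> measurable (M \<Otimes>\<^sub>M count_space (UNIV :: 'b::countable set)) N"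
    by (rule measurable_compose_countable[OF _ measurable_snd])
      (rule measurable_compose[OF measurable_fst assms])
  then show ?thesis by simp
qed

subsection \<open>Independent and Poisson random variables\<close>

text \<open>Restricting to \<open>A\<close> and pushing forward along \<open>g\<close> only rescales
  the law of \<open>g\<close>, because \<open>A\<close> is independent of every event of
  \<open>g\<close>. This will separate the gain of a link from the event that the link is
  active.\<close>

lemma (in prob_space) nn_integral_indicator_indep:
  fixes g :: "'a \<Rightarrow> real" and f :: "real \<Rightarrow> ennreal"
  assumes A[measurable]: "A \<in> events"
    and g[measurable]: "g \<in> borel_measurable M"
    and f[measurable]: "f \<in> borel_measurable borel"
    and indep: "\<And>B. B \<in> sets borel \<Longrightarrow>
      prob (A \<inter> (g -` B \<inter> space M)) = prob A * prob (g -` B \<inter> space M)"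
  shows "(\<integral>\<^sup>+\<omega>. indicator A \<omega> * f (g \<omega>) \<partial>M) = emeasure M A * (\<integral>\<^sup>+\<omega>. f (g \<omega>) \<partial>M)"
proof -
  have eq: "distr (density M (indicator A)) borel g = scale_measure (emeasure M A) (distr M borel g)"
  proof (rule measure_eqI)
    fix B :: "real set" assume "B \<in> sets (distr (density M (indicator A)) borel g)"
    then have B: "B \<in> sets borel" by simp
    have gB: "g -` B \<inter> space M \<in> events" using g B by (rule measurable_sets)
    have "emeasure (distr (density M (indicator A)) borel g) B
        = emeasure (density M (indicator A)) (g -` B \<inter> space M)"
      using B by (subst emeasure_distr) auto
    also have "\<dots> = emeasure M (A \<inter> (g -` B \<inter> space M))"
      using gB by (subst emeasure_density) (auto simp: indicator_inter_arith[symmetric] nn_integral_indicator)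
    also have "\<dots> = emeasure M A * emeasure M (g -` B \<inter> space M)"
      using indep[OF B] by (simp add: emeasure_eq_measure ennreal_mult)
    also have "\<dots> = emeasure (scale_measure (emeasure M A) (distr M borel g)) B"
      using B by (simp add: emeasure_distr)
    finally show "emeasure (distr (density M (indicator A)) borel g) B = \<dots>" .
  qed simp
  have "(\<integral>\<^sup>+\<omega>. indicator A \<omega> * f (g \<omega>) \<partial>M) = (\<integral>\<^sup>+x. f x \<partial>distr (density M (indicator A)) borel g)"
    by (simp add: nn_integral_distr nn_integral_density)
  also have "\<dots> = emeasure M A * (\<integral>\<^sup>+\<omega>. f (g \<omega>) \<partial>M)"
    unfolding eq by (simp add: nn_integral_scale_measure nn_integral_distr)
  finally show ?thesis .
qed

lemma (in prob_space) nn_integral_poisson: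
  fixes N :: "'a \<Rightarrow> nat"
  assumes N[measurable]: "N \<in> measurable M (count_space UNIV)" and l: "0 \<le> l"
    and p: "\<And>k. \<P>(\<omega> in M. N \<omega> = k) = l ^ k / fact k * exp (- l)"
  shows "(\<integral>\<^sup>+\<omega>. of_nat (N \<omega>) \<partial>M) = ennreal l"
proof -
  have eq: "distr M (count_space UNIV) N
      = density (count_space UNIV) (\<lambda>k. ennreal (l ^ k / fact k * exp (- l)))"
  proof (rule measure_eqI_countable[of _ UNIV])
    fix k :: nat
    have "emeasure (distr M (count_space UNIV) N) {k} = \<P>(\<omega> in M. N \<omega> = k)"
      by (subst emeasure_distr) (auto simp: emeasure_eq_measure vimage_def Int_def conj_commute)
    then show "emeasure (distr M (count_space UNIV) N) {k} =
      emeasure (density (count_space UNIV) (\<lambda>k. ennreal (l ^ k / fact k * exp (- l)))) {k}"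
      using p[of k] by (simp add: emeasure_density nn_integral_count_space_indicator[symmetric])
  qed auto
  have "(\<lambda>k. l ^ k / fact k) sums exp l"
    using exp_converges[of l] by (simp add: field_simps)
  then have s: "(\<lambda>k. l * exp (- l) * (l ^ k / fact k)) sums (l * exp (- l) * exp l)"
    by (rule sums_mult)
  \<comment> \<open>The factor \<open>Suc k\<close> cancels against \<open>fact (Suc k)\<close>,
    which leaves \<open>l * exp (- l)\<close> times the exponential series.\<close>
  have s': "(\<lambda>k. real (Suc k) * (l ^ Suc k / fact (Suc k) * exp (- l))) sums l"
  proof -
    have t: "real (Suc k) * (l ^ Suc k / fact (Suc k) * exp (- l)) = l * exp (- l) * (l ^ k / fact k)" for k
      by (simp add: divide_simps)
    have "l * exp (- l) * exp l = l" by (simp add: exp_minus)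
    with s show ?thesis unfolding t by simp
  qed
  \<comment> \<open>The term at \<open>k = 0\<close> vanishes, so undoing the shift does not change
    the sum.\<close>
  have s'': "(\<lambda>k. real k * (l ^ k / fact k * exp (- l))) sums l"
    using s' by (subst (asm) sums_Suc_iff) simp
  have "(\<integral>\<^sup>+\<omega>. of_nat (N \<omega>) \<partial>M) = (\<integral>\<^sup>+k. of_nat k \<partial>distr M (count_space UNIV) N)"
    by (simp add: nn_integral_distr)
  also have "\<dots> = (\<integral>\<^sup>+k. ennreal (real k * (l ^ k / fact k * exp (- l))) \<partial>count_space UNIV)"
    unfolding eq using l
    by (subst nn_integral_density)
      (auto intro!: nn_integral_cong simp: ennreal_of_nat_eq_real_of_nat ennreal_mult[symmetric] mult.commute)
  also have "\<dots> = (\<Sum>k. ennreal (real k * (l ^ k / fact k * exp (- l))))"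
    by (rule nn_integral_count_space_nat)
  also have "\<dots> = ennreal l"
    using s'' l by (intro suminf_ennreal_eq) auto
  finally show ?thesis .
qed

subsection \<open>Logarithmic layer-cake formula\<close>

lemma ln_1_plus_eq_nn_integral:
  fixes y :: real
  assumes "0 \<le> y"
  shows "ennreal (ln (1 + y)) = (\<integral>\<^sup>+x. ennreal (1 / (1 + x)) * indicator {0..y} x \<partial>lborel)"
proof -
  have "(\<integral>\<^sup>+x. ennreal (1 / (1 + x)) * indicator {0..y} x \<partial>lborel) = ennreal (ln (1 + y) - ln (1 + 0))"
    using assms
    by (intro nn_integral_FTC_Icc) (auto intro!: derivative_eq_intros)
  then show ?thesis by simp
qed

lemma (in prob_space) nn_integral_ln_1_plus:
  fixes X :: "'a \<Rightarrow> real"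
  assumes X[measurable]: "X \<in> borel_measurable M" and nonneg: "\<And>\<omega>. \<omega> \<in> space M \<Longrightarrow> 0 \<le> X \<omega>"
  shows "(\<integral>\<^sup>+\<omega>. ennreal (ln (1 + X \<omega>)) \<partial>M)
    = (\<integral>\<^sup>+x. ennreal (indicator {0..} x * ((1 - \<P>(\<omega> in M. X \<omega> < x)) / (1 + x))) \<partial>lborel)"
proof -
  interpret L: pair_sigma_finite M "lborel :: real measure" ..
  have "(\<integral>\<^sup>+\<omega>. ennreal (ln (1 + X \<omega>)) \<partial>M)
      = (\<integral>\<^sup>+\<omega>. \<integral>\<^sup>+x. ennreal (1 / (1 + x)) * indicator {0..X \<omega>} x \<partial>lborel \<partial>M)"
    using nonneg by (intro nn_integral_cong ln_1_plus_eq_nn_integral) auto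
  \<comment> \<open>As a condition on the pair, membership in the moving interval
    \<open>{0..X \<omega>}\<close> is visibly jointly measurable, which the exchange of integrals
    demands.\<close>
  also have "\<dots> = (\<integral>\<^sup>+\<omega>. \<integral>\<^sup>+x. (if 0 \<le> x \<and> x \<le> X \<omega> then ennreal (1 / (1 + x)) else 0) \<partial>lborel \<partial>M)"
    by (intro nn_integral_cong) (auto split: split_indicator)
  also have "\<dots> = (\<integral>\<^sup>+x. \<integral>\<^sup>+\<omega>. (if 0 \<le> x \<and> x \<le> X \<omega> then ennreal (1 / (1 + x)) else 0) \<partial>M \<partial>lborel)"
    by (rule L.Fubini'[symmetric]) measurable
  also have "\<dots> = (\<integral>\<^sup>+x. ennreal (indicator {0..} x * ((1 - \<P>(\<omega> in M. X \<omega> < x)) / (1 + x))) \<partial>lborel)"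
  proof (rule nn_integral_cong)
    fix x :: real
    show "(\<integral>\<^sup>+\<omega>. (if 0 \<le> x \<and> x \<le> X \<omega> then ennreal (1 / (1 + x)) else 0) \<partial>M)
        = ennreal (indicator {0..} x * ((1 - \<P>(\<omega> in M. X \<omega> < x)) / (1 + x)))"
    proof (cases "0 \<le> x")
      case True
      have "1 - \<P>(\<omega> in M. X \<omega> < x) = \<P>(\<omega> in M. \<not> X \<omega> < x)"
        by (subst prob_neg) simp_all
      then have p: "1 - \<P>(\<omega> in M. X \<omega> < x) = \<P>(\<omega> in M. x \<le> X \<omega>)"
        by (simp add: not_less)
      have "(\<integral>\<^sup>+\<omega>. (if 0 \<le> x \<and> x \<le> X \<omega> then ennreal (1 / (1 + x)) else 0) \<partial>M)
          = (\<integral>\<^sup>+\<omega>. ennreal (1 / (1 + x)) * indicator {\<omega>\<in>space M. x \<le> X \<omega>} \<omega> \<partial>M)"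
        using True by (intro nn_integral_cong) (auto split: split_indicator)
      also have "\<dots> = ennreal (1 / (1 + x)) * emeasure M {\<omega>\<in>space M. x \<le> X \<omega>}"
        by (rule nn_integral_cmult_indicator) measurable
      also have "\<dots> = ennreal ((1 - \<P>(\<omega> in M. X \<omega> < x)) / (1 + x))"
        unfolding p emeasure_eq_measure using True by (simp add: ennreal_mult[symmetric])
      finally show ?thesis using True by simp
    qed simp
  qed
  finally show ?thesis .
qed

text \<open>Integrability of the logarithm makes the common value in
  \<open>nn_integral_ln_1_plus\<close> finite. A nonnegative measurable function with finite
  integral is integrable, so both claims follow from one
  \<open>has_bochner_integral\<close>.\<close>

lemma (in prob_space) expectation_ln_1_plus:
  fixes X :: "'a \<Rightarrow> real"
  assumes X[measurable]: "X \<in> borel_measurable M" and nonneg: "\<And>\<omega>. \<omega> \<in> space M \<Longrightarrow> 0 \<le> X \<omega>"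
    and int: "integrable M (\<lambda>\<omega>. ln (1 + X \<omega>))"
  shows "set_integrable lborel {0..} (\<lambda>x. (1 - \<P>(\<omega> in M. X \<omega> < x)) / (1 + x))"
    and "expectation (\<lambda>\<omega>. ln (1 + X \<omega>))
      = (LINT x:{0..}|lborel. (1 - \<P>(\<omega> in M. X \<omega> < x)) / (1 + x))"
proof -
  have nn: "0 \<le> indicator {0..} x * ((1 - \<P>(\<omega> in M. X \<omega> < x)) / (1 + x))" for x :: real
    using prob_le_1 by (auto split: split_indicator)
  have ln_nn: "0 \<le> ln (1 + X \<omega>)" if "\<omega> \<in> space M" for \<omega>
    using nonneg[OF that] by simp
  have "(\<lambda>x. \<P>(\<omega> in M. X \<omega> < x)) \<in> borel_measurable lborel"
    by measurable
  then have meas: "(\<lambda>x. indicator {0..} x * ((1 - \<P>(\<omega> in M. X \<omega> < x)) / (1 + x)))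
      \<in> borel_measurable lborel"
    by measurable
  have eq: "(\<integral>\<^sup>+x. ennreal (indicator {0..} x * ((1 - \<P>(\<omega> in M. X \<omega> < x)) / (1 + x))) \<partial>lborel)
      = ennreal (expectation (\<lambda>\<omega>. ln (1 + X \<omega>)))"
    using nn_integral_eq_integral[OF int] nn_integral_ln_1_plus[OF X nonneg] ln_nn by (simp add: AE_I2)
  have "has_bochner_integral lborel (\<lambda>x. indicator {0..} x * ((1 - \<P>(\<omega> in M. X \<omega> < x)) / (1 + x)))
      (expectation (\<lambda>\<omega>. ln (1 + X \<omega>)))"
    using meas nn eq ln_nn by (intro has_bochner_integral_nn_integral) auto
  then show "set_integrable lborel {0..} (\<lambda>x. (1 - \<P>(\<omega> in M. X \<omega> < x)) / (1 + x))"
    and "expectation (\<lambda>\<omega>. ln (1 + X \<omega>))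
      = (LINT x:{0..}|lborel. (1 - \<P>(\<omega> in M. X \<omega> < x)) / (1 + x))"
    unfolding set_integrable_def set_lebesgue_integral_def
    by (auto simp: has_bochner_integral_iff)
qed

subsection \<open>Generic elements of a random index set\<close>

text \<open>A sum of membership probabilities stays meaningful when \<open>A \<omega>\<close> is
  infinite, where \<open>card\<close> would default to 0. It is also the mass of the graph of
  \<open>A\<close>, by which \<open>generic\<close> normalises.\<close>

definition expected_number :: "'a measure \<Rightarrow> ('a \<Rightarrow> nat set) \<Rightarrow> ennreal" where
  "expected_number M A = (\<Sum>i. emeasure M {\<omega> \<in> space M. i \<in> A \<omega>})"

text \<open>Instantiated below for the transmitters located in the cell and for the active ones
  among them.\<close>

locale random_index_set = prob_space M for M :: "'a measure" +
  fixes A :: "'a \<Rightarrow> nat set"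
  assumes measurable_index[measurable]: "\<And>i. Measurable.pred M (\<lambda>\<omega>. i \<in> A \<omega>)"
begin

sublocale pair: pair_sigma_finite M "count_space (UNIV :: nat set)"
  by (intro pair_sigma_finite.intro sigma_finite_measure_axioms sigma_finite_measure_count_space)

definition graph :: "('a \<times> nat) set" where
  "graph = {(\<omega>, i). \<omega> \<in> space M \<and> i \<in> A \<omega>}"

lemma graph_sets[measurable]: "graph \<in> sets (M \<Otimes>\<^sub>M count_space UNIV)"
proof -
  have "Measurable.pred (M \<Otimes>\<^sub>M count_space UNIV) (\<lambda>z. snd z \<in> A (fst z))"
    by (rule measurable_pair_countable) simp
  then have "{z \<in> space (M \<Otimes>\<^sub>M count_space UNIV). snd z \<in> A (fst z)} \<in> sets (M \<Otimes>\<^sub>M count_space UNIV)"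
    by (rule predE)
  also have "{z \<in> space (M \<Otimes>\<^sub>M count_space UNIV). snd z \<in> A (fst z)} = graph"
    by (auto simp: graph_def space_pair_measure)
  finally show ?thesis .
qed

lemma generic_eq: "generic M A = uniform_measure (M \<Otimes>\<^sub>M count_space UNIV) graph"
  by (simp add: generic_def graph_def)

lemma sets_generic[measurable_cong]: "sets (generic M A) = sets (M \<Otimes>\<^sub>M count_space UNIV)"
  by (simp add: generic_eq)

lemma space_generic: "space (generic M A) = space M \<times> UNIV"
  by (simp add: generic_eq space_pair_measure)

text \<open>Tonelli with the index outermost: each summand concerns a single index, the form in
  which independence can be applied link by link.\<close>

lemma nn_integral_graph:
  assumes f[measurable]: "f \<in> borel_measurable (M \<Otimes>\<^sub>M count_space UNIV)"
  shows "(\<integral>\<^sup>+z. f z * indicator graph z \<partial>(M \<Otimes>\<^sub>M count_space UNIV))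
    = (\<Sum>i. \<integral>\<^sup>+\<omega>. indicator {\<omega> \<in> space M. i \<in> A \<omega>} \<omega> * f (\<omega>, i) \<partial>M)"
proof -
  have "(\<integral>\<^sup>+z. f z * indicator graph z \<partial>(M \<Otimes>\<^sub>M count_space UNIV))
      = (\<integral>\<^sup>+i. \<integral>\<^sup>+\<omega>. f (\<omega>, i) * indicator graph (\<omega>, i) \<partial>M \<partial>count_space UNIV)"
    by (rule pair.nn_integral_snd[symmetric]) measurable
  also have "\<dots> = (\<Sum>i. \<integral>\<^sup>+\<omega>. f (\<omega>, i) * indicator graph (\<omega>, i) \<partial>M)"
    by (rule nn_integral_count_space_nat)
  also have "\<dots> = (\<Sum>i. \<integral>\<^sup>+\<omega>. indicator {\<omega> \<in> space M. i \<in> A \<omega>} \<omega> * f (\<omega>, i) \<partial>M)"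
    by (intro suminf_cong nn_integral_cong) (auto simp: graph_def split: split_indicator)
  finally show ?thesis .
qed

lemma emeasure_graph:
  "emeasure (M \<Otimes>\<^sub>M count_space UNIV) graph = expected_number M A"
  using nn_integral_graph[of "\<lambda>_. 1"] by (simp add: expected_number_def)

text \<open>Integrating the indicator of the graph over the index first gives the size of the
  section \<open>A \<omega>\<close>. Finiteness matters because the counting measure of an infinite
  set is infinite while its \<open>card\<close> is 0.\<close>

lemma expected_number_card:
  assumes "AE \<omega> in M. finite (A \<omega>)"
  shows "expected_number M A = (\<integral>\<^sup>+\<omega>. of_nat (card (A \<omega>)) \<partial>M)"
proof -
  have "expected_number M A = (\<integral>\<^sup>+\<omega>. emeasure (count_space UNIV) (Pair \<omega> -` graph) \<partial>M)"
    unfolding emeasure_graph[symmetric] by (rule pair.M2.emeasure_pair_measure_alt) simp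
  also have "\<dots> = (\<integral>\<^sup>+\<omega>. of_nat (card (A \<omega>)) \<partial>M)"
  proof (rule nn_integral_cong_AE)
    from assms AE_space show "AE \<omega> in M. emeasure (count_space UNIV) (Pair \<omega> -` graph) = of_nat (card (A \<omega>))"
    proof eventually_elim
      case (elim \<omega>)
      then have "Pair \<omega> -` graph = A \<omega>" by (auto simp: graph_def)
      with elim show ?case by simp
    qed
  qed
  finally show ?thesis .
qed

lemma nn_integral_generic:
  assumes f: "f \<in> borel_measurable (M \<Otimes>\<^sub>M count_space UNIV)"
  shows "(\<integral>\<^sup>+z. f z \<partial>generic M A)
    = (\<Sum>i. \<integral>\<^sup>+\<omega>. indicator {\<omega> \<in> space M. i \<in> A \<omega>} \<omega> * f (\<omega>, i) \<partial>M) / expected_number M A"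
  unfolding generic_eq using f
  by (simp add: nn_integral_uniform_measure nn_integral_graph emeasure_graph)

lemma prob_space_generic:
  assumes "expected_number M A \<noteq> 0" "expected_number M A \<noteq> \<infinity>"
  shows "prob_space (generic M A)"
  unfolding generic_eq using assms by (intro prob_space_uniform_measure) (simp_all add: emeasure_graph)

text \<open>Under the generic law the probability of a mark is a quotient of two expected numbers,
  so multiplying by the denominator gives the mean size of the thinned set. This converts
  \<open>operable_generic\<close> into a mean number of operable transmitters.\<close>

lemma prob_generic:
  assumes [measurable]: "\<And>i. Measurable.pred M (P i)"
    and m: "expected_number M A = ennreal m" "0 < m"
    and q: "\<P>(z in generic M A. P (snd z) (fst z)) = q"
  shows "expected_number M (\<lambda>\<omega>. {i \<in> A \<omega>. P i \<omega>}) = ennreal (q * m)"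
proof -
  interpret G: prob_space "generic M A" by (rule prob_space_generic) (use m in auto)
  have [measurable]: "Measurable.pred (M \<Otimes>\<^sub>M count_space UNIV) (\<lambda>z. P (snd z) (fst z))"
    by (rule measurable_pair_countable) simp
  have "{z \<in> space (M \<Otimes>\<^sub>M count_space UNIV). P (snd z) (fst z)} \<in> sets (M \<Otimes>\<^sub>M count_space UNIV)"
    by measurable
  then have Q: "{z \<in> space (generic M A). P (snd z) (fst z)} \<in> sets (M \<Otimes>\<^sub>M count_space UNIV)"
    by (simp add: space_generic space_pair_measure)
  have "ennreal q = (\<integral>\<^sup>+z. indicator {z \<in> space (generic M A). P (snd z) (fst z)} z \<partial>generic M A)"
    using Q by (simp add: sets_generic G.emeasure_eq_measure q)
  also have "\<dots> = (\<Sum>i. \<integral>\<^sup>+\<omega>. indicator {\<omega> \<in> space M. i \<in> A \<omega>} \<omega> *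
      indicator {z \<in> space (generic M A). P (snd z) (fst z)} (\<omega>, i) \<partial>M) / expected_number M A"
    using Q by (intro nn_integral_generic) simp
  also have "(\<Sum>i. \<integral>\<^sup>+\<omega>. indicator {\<omega> \<in> space M. i \<in> A \<omega>} \<omega> *
      indicator {z \<in> space (generic M A). P (snd z) (fst z)} (\<omega>, i) \<partial>M)
      = (\<Sum>i. \<integral>\<^sup>+\<omega>. indicator {\<omega> \<in> space M. i \<in> {i \<in> A \<omega>. P i \<omega>}} \<omega> \<partial>M)"
    by (intro suminf_cong nn_integral_cong) (auto simp: space_generic split: split_indicator)
  also have "\<dots> = expected_number M (\<lambda>\<omega>. {i \<in> A \<omega>. P i \<omega>})"
    unfolding expected_number_def by (intro suminf_cong nn_integral_indicator) simp
  finally have "ennreal q = expected_number M (\<lambda>\<omega>. {i \<in> A \<omega>. P i \<omega>}) / ennreal m"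
    by (simp add: m)
  then have "ennreal q * ennreal m = expected_number M (\<lambda>\<omega>. {i \<in> A \<omega>. P i \<omega>})"
    using m(2) by (simp add: ennreal_divide_times)
  moreover have "0 \<le> q" using q measure_nonneg by auto
  ultimately show ?thesis using m(2) by (simp add: ennreal_mult)
qed

text \<open>Campbell's formula for real \<open>f\<close>: the generic law has density
  \<open>indicator graph / m\<close>, so \<open>m\<close> times its integral is an integral over the
  graph, and Fubini with the index innermost turns that into an expected sum.\<close>

lemma campbell:
  fixes f :: "'a \<times> nat \<Rightarrow> real"
  assumes fin: "AE \<omega> in M. finite (A \<omega>)"
    and m: "expected_number M A = ennreal m" "0 < m"
    and f[measurable]: "\<And>i. (\<lambda>\<omega>. f (\<omega>, i)) \<in> borel_measurable M"
    and int: "integrable (generic M A) f"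
  shows "integrable M (\<lambda>\<omega>. \<Sum>i\<in>A \<omega>. f (\<omega>, i))"
    and "(\<integral>\<omega>. (\<Sum>i\<in>A \<omega>. f (\<omega>, i)) \<partial>M) = m * (\<integral>z. f z \<partial>generic M A)"
proof -
  let ?P = "M \<Otimes>\<^sub>M count_space (UNIV :: nat set)"
  have fm[measurable]: "f \<in> borel_measurable ?P"
    using f by (rule measurable_pair_countable)
  \<comment> \<open>The Bochner integral rules want a real-valued density, so the quotient in
    \<open>ennreal\<close> is replaced by a real one.\<close>
  have gen: "generic M A = density ?P (\<lambda>z. ennreal (indicator graph z / m))"
    unfolding generic_eq uniform_measure_def emeasure_graph m(1)
  proof (rule density_cong)
    have "indicator graph z / ennreal m = ennreal (indicator graph z / m)" for z
    proof (cases "z \<in> graph")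
      case True
      have "1 / ennreal m = ennreal (1 / m)"
        using divide_ennreal[of 1 m] m(2) by simp
      with True show ?thesis by simp
    qed simp
    then show "AE z in ?P. indicator graph z / ennreal m = ennreal (indicator graph z / m)" by simp
  qed measurable
  have int_P: "integrable ?P (\<lambda>z. indicator graph z / m * f z)"
    using int m(2) unfolding gen by (subst (asm) integrable_real_density) auto
  have "integrable ?P (\<lambda>z. m * (indicator graph z / m * f z))"
    by (rule integrable_mult_right[OF int_P])
  then have int_g: "integrable ?P (\<lambda>z. indicator graph z * f z)"
    using m(2) by simp
  have "(\<integral>z. f z \<partial>generic M A) = (\<integral>z. indicator graph z / m * f z \<partial>?P)"
    unfolding gen using m(2) by (intro integral_real_density) auto
  then have eq: "m * (\<integral>z. f z \<partial>generic M A) = (\<integral>z. indicator graph z * f z \<partial>?P)"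
    using m(2) by simp
  \<comment> \<open>Where \<open>A \<omega>\<close> is finite, the integrand has finite support and
    its integral against the counting measure is a plain sum.\<close>
  have inner: "AE \<omega> in M. (\<integral>i. indicator graph (\<omega>, i) * f (\<omega>, i) \<partial>count_space UNIV) = (\<Sum>i\<in>A \<omega>. f (\<omega>, i))"
    using fin AE_space
  proof eventually_elim
    case (elim \<omega>)
    then have sub: "{i \<in> UNIV. indicator graph (\<omega>, i) * f (\<omega>, i) \<noteq> 0} \<subseteq> A \<omega>"
      by (auto simp: graph_def split: split_indicator_asm)
    have "(\<integral>i. indicator graph (\<omega>, i) * f (\<omega>, i) \<partial>count_space UNIV)
        = (\<Sum>i | i \<in> UNIV \<and> indicator graph (\<omega>, i) * f (\<omega>, i) \<noteq> 0. indicator graph (\<omega>, i) * f (\<omega>, i))"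
      by (rule lebesgue_integral_count_space_finite_support) (use elim sub finite_subset in blast)
    also have "\<dots> = (\<Sum>i\<in>A \<omega>. f (\<omega>, i))"
      using elim sub by (intro sum.mono_neutral_cong_left) (auto simp: graph_def)
    finally show ?case .
  qed
  have fin_meas: "Measurable.pred M (\<lambda>\<omega>. finite (A \<omega>))"
    unfolding finite_nat_set_iff_bounded_le Ball_def by measurable
  \<comment> \<open>For infinite \<open>A \<omega>\<close> both sides are 0 by convention, so the
    equality holds everywhere and measurability carries over.\<close>
  have "(\<lambda>\<omega>. \<Sum>i\<in>A \<omega>. f (\<omega>, i)) = (\<lambda>\<omega>. if finite (A \<omega>) then
      (\<Sum>i. if i \<in> A \<omega> then f (\<omega>, i) else 0) else 0)"
  proof
    fix \<omega>
    show "(\<Sum>i\<in>A \<omega>. f (\<omega>, i)) = (if finite (A \<omega>) then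
      (\<Sum>i. if i \<in> A \<omega> then f (\<omega>, i) else 0) else 0)"
      by (auto simp: suminf_finite[where N = "A \<omega>"])
  qed
  also have "\<dots> \<in> borel_measurable M"
    using fin_meas by measurable
  finally have sm[measurable]: "(\<lambda>\<omega>. \<Sum>i\<in>A \<omega>. f (\<omega>, i)) \<in> borel_measurable M" .
  have im[measurable]: "(\<lambda>\<omega>. \<integral>i. indicator graph (\<omega>, i) * f (\<omega>, i) \<partial>count_space UNIV) \<in> borel_measurable M"
    using pair.integrable_fst'[OF int_g] by (rule borel_measurable_integrable)
  show "integrable M (\<lambda>\<omega>. \<Sum>i\<in>A \<omega>. f (\<omega>, i))"
    using pair.integrable_fst'[OF int_g] integrable_cong_AE[OF im sm inner] by simp
  show "(\<integral>\<omega>. (\<Sum>i\<in>A \<omega>. f (\<omega>, i)) \<partial>M) = m * (\<integral>z. f z \<partial>generic M A)"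
    unfolding eq pair.integral_fst'[OF int_g, symmetric]
    by (rule integral_cong_AE[OF sm im]) (use inner in eventually_elim, auto)
qed

end

subsection \<open>The network\<close>

context ftp_network
begin

sublocale prob_space "prob_sp S"
  by (rule prob_space_prob_sp)

lemma tx_measurable[measurable]: "tx_pos S j \<in> borel_measurable (prob_sp S)"
  using tx_ppp by (simp add: homogeneous_ppp_def)

declare rx_measurable[measurable] cell_user_measurable[measurable]
  operable_measurable[measurable] access_measurable[measurable]

lemma gain_measurable[measurable]: "gain S j i \<in> borel_measurable (prob_sp S)"
  using distributed_measurable[OF gain_exponential[of j i]] by simp

lemma cell_gain_measurable[measurable]: "cell_gain S i \<in> borel_measurable (prob_sp S)"
  using distributed_measurable[OF cell_gain_exponential[of i]] by simp

lemma cell_borel[measurable]: "cell S \<in> sets borel"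
  by (simp add: cell_def)

section \<open>Mean number of transmitters in the cell\<close>

lemma bounded_cell: "bounded (cell S)"
  by (simp add: cell_def)

lemma measure_cell: "measure lborel (cell S) = pi * (cell_radius S)\<^sup>2"
  using radius_pos by (simp add: cell_def content_cball unit_ball_vol_2)

lemma finite_tx_in_cell: "AE \<omega> in prob_sp S. finite {j. tx_pos S j \<omega> \<in> cell S}"
  using tx_ppp cell_borel bounded_cell unfolding homogeneous_ppp_def by blast

lemma card_tx_in_cell_measurable:
  "(\<lambda>\<omega>. card {j. tx_pos S j \<omega> \<in> cell S}) \<in> measurable (prob_sp S) (count_space UNIV)"
proof -
  \<comment> \<open>Read off from the independence clause of \<^const>\<open>homogeneous_ppp\<close> for a padded family.\<close>
  let ?A = "\<lambda>n::nat. if n = 0 then cell S else {}"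
  have "(\<forall>n. ?A n \<in> sets borel \<and> bounded (?A n)) \<and> disjoint_family ?A"
    using bounded_cell by (auto simp: disjoint_family_on_def)
  then have "indep_vars (\<lambda>_. count_space UNIV) (\<lambda>n \<omega>. card {j. tx_pos S j \<omega> \<in> ?A n}) UNIV"
    by (rule tx_ppp[unfolded homogeneous_ppp_def, THEN conjunct2, THEN conjunct2, rule_format])
  then have "\<forall>n. (\<lambda>\<omega>. card {j. tx_pos S j \<omega> \<in> ?A n}) \<in> measurable (prob_sp S) (count_space UNIV)"
    unfolding indep_vars_def by auto
  from this[rule_format, of 0] show ?thesis by simp
qed

sublocale tx_in_cell: random_index_set "prob_sp S" "\<lambda>\<omega>. {j. tx_pos S j \<omega> \<in> cell S}"
  by unfold_locales simp

lemma expected_number_tx_in_cell: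
  "expected_number (prob_sp S) (\<lambda>\<omega>. {j. tx_pos S j \<omega> \<in> cell S})
    = ennreal (d2d_density S * (pi * (cell_radius S)\<^sup>2))"
proof -
  have "\<P>(\<omega> in prob_sp S. card {j. tx_pos S j \<omega> \<in> cell S} = k) =
      (d2d_density S * (pi * (cell_radius S)\<^sup>2)) ^ k / fact k
        * exp (- (d2d_density S * (pi * (cell_radius S)\<^sup>2)))" for k
    using tx_ppp cell_borel bounded_cell unfolding homogeneous_ppp_def measure_cell[symmetric] by blast
  with nn_integral_poisson[OF card_tx_in_cell_measurable] show ?thesis
    using density_pos by (simp add: tx_in_cell.expected_number_card[OF finite_tx_in_cell])
qed

section \<open>Independence of operability, access and own gain\<close>

definition operable_event :: "nat \<Rightarrow> 'a set" where
  "operable_event j = {\<omega> \<in> space (prob_sp S). tx_pos S j \<omega> \<in> cell S \<and> operable S j \<omega>}"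

definition access_event :: "nat \<Rightarrow> 'a set" where
  "access_event j = {\<omega> \<in> space (prob_sp S). access S j \<omega>}"

text \<open>The first factor is an event of the source \<open>Pairs\<close>, the second of the
  source \<open>Access j\<close>; this split is what lets \<open>independent_sources\<close>
  act.\<close>

lemma active_event_eq:
  "{\<omega> \<in> space (prob_sp S). j \<in> active_in_cell S \<omega>} = operable_event j \<inter> access_event j"
  by (auto simp: operable_event_def access_event_def active_in_cell_def active_def)

lemma operable_event_source: "operable_event j \<in> source_events S Pairs"
proof -
  let ?f = "\<lambda>\<omega> j. (tx_pos S j \<omega>, rx_pos S j \<omega>, operable S j \<omega>)"
  let ?N = "\<Pi>\<^sub>M j\<in>(UNIV :: nat set). (borel \<Otimes>\<^sub>M borel \<Otimes>\<^sub>M count_space UNIV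
      :: ((real^2) \<times> (real^2) \<times> bool) measure)"
  have "{h \<in> space ?N. fst (h j) \<in> cell S \<and> snd (snd (h j))} \<in> sets ?N"
    by measurable
  then have "?f -` {h \<in> space ?N. fst (h j) \<in> cell S \<and> snd (snd (h j))} \<inter> space (prob_sp S)
      \<in> source_events S Pairs"
    unfolding source_events.simps by (rule in_vimage_algebra)
  also have "?f -` {h \<in> space ?N. fst (h j) \<in> cell S \<and> snd (snd (h j))} \<inter> space (prob_sp S)
      = operable_event j"
    by (auto simp: operable_event_def space_PiM space_pair_measure)
  finally show ?thesis .
qed

lemma access_event_source: "access_event j \<in> source_events S (Access j)"
proof -
  have "access S j -` {True} \<inter> space (prob_sp S) \<in> source_events S (Access j)"
    unfolding source_events.simps by (rule in_vimage_algebra) simp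
  also have "access S j -` {True} \<inter> space (prob_sp S) = access_event j"
    by (auto simp: access_event_def)
  finally show ?thesis .
qed

lemma gain_event_source:
  "B \<in> sets borel \<Longrightarrow> gain S j i -` B \<inter> space (prob_sp S) \<in> source_events S (Gain j i)"
  unfolding source_events.simps by (rule in_vimage_algebra)

lemma prob_active_event:
  "prob (operable_event j \<inter> access_event j) = prob (operable_event j) * tx_prob S"
proof -
  let ?A = "\<lambda>s. if s = Pairs then operable_event j else access_event j"
  have "prob (\<Inter>s\<in>{Pairs, Access j}. ?A s) = (\<Prod>s\<in>{Pairs, Access j}. prob (?A s))"
    using operable_event_source[of j] access_event_source[of j]
    by (intro indep_setsD[OF independent_sources]) (auto simp del: source_events.simps)
  then show ?thesis using access_prob[of j] by (simp add: access_event_def Int_commute)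
qed

text \<open>The three events come from the distinct sources \<open>Pairs\<close>,
  \<open>Access j\<close> and \<open>Gain j j\<close>, so their probabilities multiply, and the
  first two factors recombine by \<open>prob_active_event\<close>.\<close>

lemma prob_active_gain:
  assumes B: "B \<in> sets borel"
  shows "prob ((operable_event j \<inter> access_event j) \<inter> (gain S j j -` B \<inter> space (prob_sp S)))
    = prob (operable_event j \<inter> access_event j) * prob (gain S j j -` B \<inter> space (prob_sp S))"
proof -
  let ?A = "\<lambda>s. if s = Pairs then operable_event j else if s = Access j then access_event j
    else gain S j j -` B \<inter> space (prob_sp S)"
  have "prob (\<Inter>s\<in>{Pairs, Access j, Gain j j}. ?A s) = (\<Prod>s\<in>{Pairs, Access j, Gain j j}. prob (?A s))"
    using operable_event_source[of j] access_event_source[of j] gain_event_source[OF B, of j j]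
    by (intro indep_setsD[OF independent_sources]) (auto simp del: source_events.simps)
  then show ?thesis
    unfolding prob_active_event access_prob[of j, folded access_event_def, symmetric]
    by (simp add: ac_simps)
qed

section \<open>Mean number of active transmitters and its positivity\<close>

sublocale active: random_index_set "prob_sp S" "active_in_cell S"
  by unfold_locales (simp add: active_in_cell_def active_def)

lemma finite_active_in_cell: "AE \<omega> in prob_sp S. finite (active_in_cell S \<omega>)"
  using finite_tx_in_cell
  by eventually_elim (auto simp: active_in_cell_def intro: rev_finite_subset)

lemma expected_number_active:
  "expected_number (prob_sp S) (active_in_cell S)
    = ennreal (active_density S * pi * (cell_radius S)\<^sup>2)"
proof -
  let ?m = "d2d_density S * (pi * (cell_radius S)\<^sup>2)"
  have m: "0 < ?m" using density_pos radius_pos by simp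
  \<comment> \<open>The closed formula is not visibly nonnegative, but
    \<open>operable_generic\<close> identifies it with a probability.\<close>
  have nn: "0 \<le> operable_prob S"
    unfolding operable_generic[symmetric] by (rule measure_nonneg)
  have "expected_number (prob_sp S) (active_in_cell S)
      = (\<Sum>j. emeasure (prob_sp S) (operable_event j) * ennreal (tx_prob S))"
    using tx_prob
    by (simp add: expected_number_def active_event_eq emeasure_eq_measure prob_active_event ennreal_mult)
  also have "\<dots> = (\<Sum>j. emeasure (prob_sp S) (operable_event j)) * ennreal (tx_prob S)"
    by simp
  also have "(\<Sum>j. emeasure (prob_sp S) (operable_event j))
      = expected_number (prob_sp S) (\<lambda>\<omega>. {j \<in> {j. tx_pos S j \<omega> \<in> cell S}. operable S j \<omega>})"
    by (simp add: expected_number_def operable_event_def)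
  also have "\<dots> = ennreal (operable_prob S * ?m)"
    by (rule tx_in_cell.prob_generic[OF _ expected_number_tx_in_cell m operable_generic]) simp
  also have "\<dots> * ennreal (tx_prob S) = ennreal (active_density S * pi * (cell_radius S)\<^sup>2)"
    using tx_prob mult_nonneg_nonneg[OF nn less_imp_le[OF m]]
    by (subst ennreal_mult[symmetric]) (simp_all add: active_density_def ac_simps)
  finally show ?thesis .
qed

text \<open>Positivity makes the mean number of active transmitters nonzero, so that the law of a
  generic link can be normalised.\<close>

lemma operable_prob_pos: "0 < operable_prob S"
proof -
  \<comment> \<open>\<open>t\<close> is the distance \<open>r\<close> at which
    \<open>mu1 S * r powr (- a)\<close> equals 1. The case split of \<open>operable_prob\<close>
    compares it with \<open>R\<close>, and powers of \<open>mu1 S\<close> become powers of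
    \<open>t\<close>.\<close>
  define a R t where "a = path_loss S" and "R = cell_radius S" and "t = mu1 S powr (1 / a)"
  have a: "2 < a" and R: "0 < R" using path_loss_gt_2 radius_pos by (auto simp: a_def R_def)
  have mu: "0 < mu1 S"
    using efficiency powers_pos tx_prob by (simp add: mu1_def)
  have t: "0 < t" using mu by (simp add: t_def)
  have t_pow: "mu1 S = t powr a" "mu1 S powr (2 / a) = t\<^sup>2"
    using mu a by (simp_all add: t_def powr_powr flip: powr_numeral)
  show ?thesis
  proof (cases "t \<le> R")
    case True
    \<comment> \<open>Over a common denominator the sign is that of \<open>a R\<^sup>a\<^sup>-\<^sup>2 - 2 t\<^sup>a\<^sup>-\<^sup>2\<close>, and \<open>t \<le> R\<close>, \<open>2 < a\<close>.\<close>
    have "t powr (a - 2) \<le> R powr (a - 2)"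
      using True t a by (intro powr_mono2) auto
    then have "2 * t powr (a - 2) \<le> 2 * R powr (a - 2)" by simp
    also have "\<dots> < a * R powr (a - 2)"
      using a R by (intro mult_strict_right_mono) auto
    \<comment> \<open>Multiplying by both squares restores the exponent \<open>a\<close> on each
      side.\<close>
    finally have "2 * t powr (a - 2) * (t powr 2 * R powr 2) < a * R powr (a - 2) * (t powr 2 * R powr 2)"
      using t R by (intro mult_strict_right_mono) auto
    then have "2 * (t powr (a - 2) * t powr 2) * R powr 2 < a * t powr 2 * (R powr (a - 2) * R powr 2)"
      by (simp only: ac_simps)
    then have *: "2 * t powr a * R\<^sup>2 < a * t\<^sup>2 * R powr a"
      using t R unfolding powr_add[symmetric] by simp
    have "operable_prob S = a * t\<^sup>2 / ((a - 2) * R\<^sup>2) + 2 * t powr a / ((2 - a) * R powr a)"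
      using True by (simp add: operable_prob_def Let_def a_def[symmetric] R_def[symmetric]
        t_def[symmetric] t_pow(2)) (simp add: t_pow(1))
    also have "\<dots> = (a * t\<^sup>2 * R powr a - 2 * t powr a * R\<^sup>2) / ((a - 2) * R\<^sup>2 * R powr a)"
      using a R by (simp add: divide_simps) (simp add: algebra_simps)
    also have "\<dots> > 0"
      using * a R by simp
    finally show ?thesis .
  next
    case False
    then show ?thesis by (simp add: operable_prob_def Let_def a_def R_def t_def)
  qed
qed

lemma active_mean_pos: "0 < active_density S * pi * (cell_radius S)\<^sup>2"
  using operable_prob_pos density_pos tx_prob radius_pos by (simp add: active_density_def)

section \<open>Measurability and pointwise bound of the SINR\<close>

lemma sinr_measurable[measurable]: "sinr S i \<in> borel_measurable (prob_sp S)"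
proof -
  \<comment> \<open>The random index set becomes a condition inside a series over all indices, whose
    terms are measurable.\<close>
  have "d2d_interference S i = (\<lambda>\<omega>. \<Sum>j. if operable S j \<omega> \<and> access S j \<omega> \<and> j \<noteq> i
      then received_power S (d2d_power S) (gain S j i \<omega>) (dist (tx_pos S j \<omega>) (rx_pos S i \<omega>)) else 0)"
    unfolding d2d_interference_def infsum_ennreal_eq_suminf
    by (auto simp: active_def fun_eq_iff intro!: suminf_cong)
  then have [measurable]: "d2d_interference S i \<in> borel_measurable (prob_sp S)"
    unfolding received_power_def by simp
  show ?thesis
    unfolding sinr_def[abs_def] received_power_def by measurable
qed

lemma sinr_nonneg: "0 \<le> sinr S i \<omega>"
  by (simp add: sinr_def)

text \<open>Discarding both interference terms leaves the positive noise power as denominator, hence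
  a bound linear in the own gain.\<close>

lemma sinr_le:
  "ennreal (sinr S i \<omega>)
    \<le> ennreal (d2d_power S / link_dist S powr path_loss S / noise_power S * gain S i i \<omega>)"
proof -
  let ?P = "received_power S (d2d_power S) (gain S i i \<omega>) (link_dist S)"
  have d: "0 < link_dist S powr path_loss S" using link_dist_pos by simp
  \<comment> \<open>Only an inequality, since \<open>enn2real\<close> sends an infinite quotient to
    0.\<close>
  have "ennreal (sinr S i \<omega>) \<le> ?P / (d2d_interference S i \<omega>
      + received_power S (cell_power S) (cell_gain S i \<omega>) (dist (cell_user S \<omega>) (rx_pos S i \<omega>))
      + ennreal (noise_power S))"
    unfolding sinr_def by (simp add: ennreal_enn2real_if)
  also have "\<dots> \<le> ?P / ennreal (noise_power S)"
    unfolding divide_ennreal_def by (intro mult_left_mono ennreal_inverse_antimono) auto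
  also have "\<dots> \<le> ennreal (d2d_power S / link_dist S powr path_loss S / noise_power S * gain S i i \<omega>)"
  proof (cases "0 \<le> gain S i i \<omega>")
    case True
    then show ?thesis
      using d powers_pos by (simp add: received_power_def divide_ennreal)
  next
    \<comment> \<open>A negative gain is a null event but is not excluded pointwise;
      \<open>ennreal\<close> then truncates the received power to 0.\<close>
    case False
    then have "d2d_power S * gain S i i \<omega> \<le> 0"
      using powers_pos by (simp add: mult_nonneg_nonpos)
    then show ?thesis by (simp add: received_power_def ennreal_neg)
  qed
  finally show ?thesis .
qed

section \<open>Integrability under the law of a generic link\<close>

lemma nn_integral_gain:
  assumes "0 \<le> K"
  shows "(\<integral>\<^sup>+\<omega>. ennreal (K * gain S j i \<omega>) \<partial>prob_sp S) = ennreal K"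
proof -
  have "(\<integral>\<^sup>+\<omega>. ennreal (K * gain S j i \<omega>) \<partial>prob_sp S)
      = (\<integral>\<^sup>+x. ennreal (exponential_density 1 x) * ennreal (K * x) \<partial>lborel)"
    by (rule distributed_nn_integral[OF gain_exponential, symmetric]) simp
  \<comment> \<open>The power \<open>x ^ 1\<close> matches the moment formula for Erlang densities,
    of which the exponential density is the case of index 0.\<close>
  also have "\<dots> = (\<integral>\<^sup>+x. ennreal K * ennreal (exponential_density 1 x * x ^ 1) \<partial>lborel)"
    using assms
    by (intro nn_integral_cong) (auto simp: exponential_density_def ennreal_mult[symmetric] ac_simps)
  also have "\<dots> = ennreal K * (\<integral>\<^sup>+x. ennreal (exponential_density 1 x * x ^ 1) \<partial>lborel)"
    by (rule nn_integral_cmult) simp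
  also have "\<dots> = ennreal K"
    by (subst nn_integral_erlang_ith_moment) simp_all
  finally show ?thesis .
qed

lemma generic_sinr_measurable[measurable]:
  "generic_sinr S \<in> borel_measurable (prob_sp S \<Otimes>\<^sub>M count_space UNIV)"
  by (rule measurable_pair_countable) (simp add: generic_sinr_def)

sublocale generic: prob_space "generic_link S"
  unfolding generic_link_def
  by (rule active.prob_space_generic) (use expected_number_active active_mean_pos in auto)

lemma generic_link_cong[measurable_cong]:
  "sets (generic_link S) = sets (prob_sp S \<Otimes>\<^sub>M count_space UNIV)"
  unfolding generic_link_def by (rule active.sets_generic)

text \<open>The SINR involves the same positions and operability as the event of being active, so
  independence is applied to its bound \<open>K * gain S i i \<omega>\<close> instead. The sum over
  links is then at most \<open>?m * K\<close>, and normalising leaves at most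
  \<open>K\<close>.\<close>

lemma generic_sinr_integrable: "integrable (generic_link S) (generic_sinr S)"
proof -
  define K where "K = d2d_power S / link_dist S powr path_loss S / noise_power S"
  have K: "0 \<le> K" using powers_pos by (simp add: K_def)
  let ?m = "expected_number (prob_sp S) (active_in_cell S)"
  have [measurable]: "operable_event i \<inter> access_event i \<in> events" for i
    unfolding active_event_eq[symmetric] by simp
  have "(\<integral>\<^sup>+z. ennreal (generic_sinr S z) \<partial>generic_link S)
      = (\<Sum>i. \<integral>\<^sup>+\<omega>. indicator (operable_event i \<inter> access_event i) \<omega> * ennreal (sinr S i \<omega>) \<partial>prob_sp S) / ?m"
    unfolding generic_link_def
    by (subst active.nn_integral_generic) (simp_all add: active_event_eq generic_sinr_def)
  also have "\<dots> \<le> (\<Sum>i. \<integral>\<^sup>+\<omega>. indicator (operable_event i \<inter> access_event i) \<omega>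
      * ennreal (K * gain S i i \<omega>) \<partial>prob_sp S) / ?m"
    by (intro divide_right_mono_ennreal suminf_le nn_integral_mono mult_left_mono sinr_le[folded K_def]) auto
  also have "\<dots> = (\<Sum>i. emeasure (prob_sp S) (operable_event i \<inter> access_event i) * ennreal K) / ?m"
    by (subst nn_integral_indicator_indep[where f = "\<lambda>x. ennreal (K * x)", OF _ gain_measurable _ prob_active_gain])
      (simp_all add: nn_integral_gain[OF K])
  also have "\<dots> = ?m * ennreal K / ?m"
    by (simp add: expected_number_def active_event_eq)
  also have "\<dots> < \<infinity>"
    using active_mean_pos K
    by (simp add: expected_number_active ennreal_mult[symmetric] divide_ennreal)
  finally show ?thesis
    by (intro integrableI_nonneg) (auto simp: generic_sinr_def sinr_nonneg)
qed

text \<open>Dominated by the SINR itself, as \<open>ln (1 + y) \<le> y\<close> for nonnegative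
  \<open>y\<close>.\<close>

lemma ln_generic_sinr_integrable: "integrable (generic_link S) (\<lambda>z. ln (1 + generic_sinr S z))"
proof (rule Bochner_Integration.integrable_bound[OF generic_sinr_integrable])
  have nn: "0 \<le> generic_sinr S z" for z by (simp add: generic_sinr_def sinr_nonneg)
  then show "AE z in generic_link S. norm (ln (1 + generic_sinr S z)) \<le> norm (generic_sinr S z)"
    by (simp add: ln_add_one_self_le_self)
qed measurable

end

text \<open>The integrability conjuncts ensure that the rate and the outage integral are genuine
  values, not the default 0 of a non-integrable function.\<close>

theorem proposition4:
  fixes S :: "'a ftp_system"
  assumes "ftp_network S"
  shows "integrable (prob_sp S) (total_rate S)
    \<and> set_integrable lborel {0..} (\<lambda>x. (1 - outage_prob S x) / (1 + x))
    \<and> avg_sum_rate S = 1 / 2 * active_density S * pi * (cell_radius S)\<^sup>2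
        * (\<integral>z. log 2 (1 + generic_sinr S z) \<partial>generic_link S)
    \<and> avg_sum_rate S = active_density S * pi * (cell_radius S)\<^sup>2 / (2 * ln 2)
        * (LINT x:{0..}|lborel. (1 - outage_prob S x) / (1 + x))"
proof -
  interpret ftp_network S by fact
  have log_int: "integrable (generic (prob_sp S) (active_in_cell S)) (\<lambda>z. log 2 (1 + generic_sinr S z))"
    using ln_generic_sinr_integrable by (simp add: log_def generic_link_def)
  have rate: "total_rate S = (\<lambda>\<omega>. \<Sum>i\<in>active_in_cell S \<omega>. log 2 (1 + generic_sinr S (\<omega>, i)))"
    by (simp add: total_rate_def generic_sinr_def fun_eq_iff)
  have meas: "(\<lambda>\<omega>. log 2 (1 + generic_sinr S (\<omega>, i))) \<in> borel_measurable (prob_sp S)" for i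
    by (simp add: generic_sinr_def)
  note campbell = active.campbell[OF finite_active_in_cell expected_number_active active_mean_pos
      meas log_int]
  \<comment> \<open>On the probability space of generic links, the probability that the SINR is
    below \<open>x\<close> is \<open>outage_prob S x\<close> by definition.\<close>
  note layer_cake = generic.expectation_ln_1_plus[of "generic_sinr S", OF _ _ ln_generic_sinr_integrable,
      folded outage_prob_def]
  have nn: "0 \<le> generic_sinr S z" for z by (simp add: generic_sinr_def sinr_nonneg)
  have eq: "avg_sum_rate S = 1 / 2 * active_density S * pi * (cell_radius S)\<^sup>2
        * (\<integral>z. log 2 (1 + generic_sinr S z) \<partial>generic_link S)"
    unfolding avg_sum_rate_def rate campbell(2) by (simp add: generic_link_def)
  \<comment> \<open>The change of base from \<open>log 2\<close> to \<open>ln\<close> supplies the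
    factor \<open>1 / ln 2\<close>.\<close>
  have log_eq: "(\<integral>z. log 2 (1 + generic_sinr S z) \<partial>generic_link S)
      = (LINT x:{0..}|lborel. (1 - outage_prob S x) / (1 + x)) / ln 2"
    using layer_cake(2) nn by (simp add: log_def)
  show ?thesis
    using campbell(1) layer_cake(1) nn eq by (simp add: log_eq rate[symmetric])
qed

end
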